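(* For every $n\ge3$, $T_n[3]=T_n[6]=PT_n$.
   Context: The twin group is $T_n=\langle s_1,\dots,s_{n-1}\mid s_k^2=1 \text{ for all } k,\ s_is_j=s_js_i \text{ for } |i-j|\ge 2\rangle$. The pure twin group $PT_n$ is the kernel of the surjection $T_n\to S_n$ sending $s_i$ to the transposition $\tau_i=(i,i+1)$ of the symmetric group $S_n$. The Tits representation $\rho:T_n\to \mathrm{GL}(n-1,\mathbb{Z})$ is given by $\rho(s_i)=X_i$, where $X_i$ is the matrix that agrees with the identity except in the $i$-th row, and whose $i$-th row has $(i,i)$-entry $-1$, $(i,i\pm1)$-entries $2$ (whenever $1\le i\pm1\le n-1$) and all other entries $0$. For $m\ge2$, $T_n[m]$ is the kernel of the composition of $\rho$ with the reduction $\mathrm{GL}(n-1,\mathbb{Z})\to\mathrm{GL}(n-1,\mathbb{Z}/m\mathbb{Z})$. The paper considers $T_n[m]$ for $n\ge3$. *)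

theory Defs
  imports
    "HOL-Algebra.Sym_Groups"
    "Jordan_Normal_Form.Matrix"
begin

section \<open>Group presentations\<close>

text \<open>A letter \<open>(a, True)\<close> stands for the generator \<open>a\<close>, and \<open>(a, False)\<close> for its formal inverse.
  A relation \<open>u = v\<close> is given as the pair \<open>(u, v)\<close>.\<close>

type_synonym 'a word = "('a \<times> bool) list"

abbreviation words :: "'a set \<Rightarrow> 'a word set" where
  "words S \<equiv> lists (S \<times> UNIV)"

inductive_set pres_cong :: "'a set \<Rightarrow> ('a word \<times> 'a word) set \<Rightarrow> ('a word \<times> 'a word) set"
  for S R where
  refl: "w \<in> words S \<Longrightarrow> (w, w) \<in> pres_cong S R"
| sym: "(u, v) \<in> pres_cong S R \<Longrightarrow> (v, u) \<in> pres_cong S R"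
| trans: "(u, v) \<in> pres_cong S R \<Longrightarrow> (v, w) \<in> pres_cong S R \<Longrightarrow> (u, w) \<in> pres_cong S R"
| append: "(u, v) \<in> pres_cong S R \<Longrightarrow> (u', v') \<in> pres_cong S R \<Longrightarrow> (u @ u', v @ v') \<in> pres_cong S R"
| cancel: "a \<in> S \<Longrightarrow> ([(a, b), (a, \<not> b)], []) \<in> pres_cong S R"
| rel: "(u, v) \<in> R \<Longrightarrow> u \<in> words S \<Longrightarrow> v \<in> words S \<Longrightarrow> (u, v) \<in> pres_cong S R"

definition presented_group :: "'a set \<Rightarrow> ('a word \<times> 'a word) set \<Rightarrow> 'a word set monoid" where
  "presented_group S R =
     \<lparr> carrier = words S // pres_cong S R,
       mult = (\<lambda>A B. \<Union>u\<in>A. \<Union>v\<in>B. pres_cong S R `` {u @ v}),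
       one = pres_cong S R `` {[]} \<rparr>"

fun letter_eval :: "('g, 'b) monoid_scheme \<Rightarrow> ('a \<Rightarrow> 'g) \<Rightarrow> 'a \<times> bool \<Rightarrow> 'g" where
  "letter_eval G f (a, b) = (if b then f a else inv\<^bsub>G\<^esub> f a)"

definition word_eval :: "('g, 'b) monoid_scheme \<Rightarrow> ('a \<Rightarrow> 'g) \<Rightarrow> 'a word \<Rightarrow> 'g" where
  "word_eval G f w = foldr (\<lambda>l x. letter_eval G f l \<otimes>\<^bsub>G\<^esub> x) w \<one>\<^bsub>G\<^esub>"

text \<open>The homomorphism out of a presented group determined by the images \<open>f\<close> of the generators.
  It is meaningful when \<open>f\<close> respects the relations; see \<open>pres_hom_class\<close> and \<open>pres_hom_hom\<close>.\<close>

definition pres_hom :: "('g, 'b) monoid_scheme \<Rightarrow> ('a \<Rightarrow> 'g) \<Rightarrow> 'a word set \<Rightarrow> 'g" where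
  "pres_hom G f C = the_elem (word_eval G f ` C)"

lemma pres_cong_words: "(u, v) \<in> pres_cong S R \<Longrightarrow> u \<in> words S \<and> v \<in> words S"
  by (induction rule: pres_cong.induct) auto

lemma equiv_pres_cong: "equiv (words S) (pres_cong S R)"
proof (rule equivI)
  show "pres_cong S R \<subseteq> words S \<times> words S"
    using pres_cong_words by (metis mem_Sigma_iff subrelI)
  show "refl_on (words S) (pres_cong S R)"
    by (rule refl_onI) (rule pres_cong.refl)
  show "sym (pres_cong S R)"
    by (rule symI) (rule pres_cong.sym)
  show "trans (pres_cong S R)"
    by (rule transI) (rule pres_cong.trans)
qed

lemma presented_group_mult_class:
  assumes "u \<in> words S" "v \<in> words S"
  shows "(pres_cong S R `` {u}) \<otimes>\<^bsub>presented_group S R\<^esub> (pres_cong S R `` {v}) = pres_cong S R `` {u @ v}"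
proof -
  let ?A = "pres_cong S R `` {u}" and ?B = "pres_cong S R `` {v}"
  have "pres_cong S R `` {u' @ v'} = pres_cong S R `` {u @ v}" if "u' \<in> ?A" "v' \<in> ?B" for u' v'
    using that equiv_class_eq[OF equiv_pres_cong pres_cong.append, of u u' S R v v'] by simp
  then have "(\<Union>u'\<in>?A. \<Union>v'\<in>?B. pres_cong S R `` {u' @ v'})
           = (\<Union>u'\<in>?A. \<Union>v'\<in>?B. pres_cong S R `` {u @ v})"
    by (intro SUP_cong HOL.refl) blast
  also have "\<dots> = pres_cong S R `` {u @ v}"
  proof -
    have "u \<in> ?A" "v \<in> ?B" using assms by (simp_all only: Image_singleton_iff pres_cong.refl)
    then have "?A \<noteq> {}" "?B \<noteq> {}" by blast+
    then show ?thesis by auto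
  qed
  finally show ?thesis by (simp add: presented_group_def)
qed

lemma presented_group_class_closed:
  "u \<in> words S \<Longrightarrow> pres_cong S R `` {u} \<in> carrier (presented_group S R)"
  unfolding presented_group_def by (simp add: quotientI)

lemma presented_group_carrierE:
  assumes "x \<in> carrier (presented_group S R)"
  obtains u where "u \<in> words S" "x = pres_cong S R `` {u}"
proof -
  from assms have "x \<in> words S // pres_cong S R" by (simp add: presented_group_def)
  then show ?thesis by (rule quotientE) (rule that)
qed

lemma presented_group_one: "\<one>\<^bsub>presented_group S R\<^esub> = pres_cong S R `` {[]}"
  unfolding presented_group_def by simp

lemma word_inverse:
  assumes "w \<in> words S"
  shows "\<exists>w' \<in> words S. (w' @ w, []) \<in> pres_cong S R"
  using assms
proof (induction w)
  case Nil
  show ?case by (rule bexI[of _ "[]"]) (auto intro: pres_cong.refl)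
next
  case (Cons l w)
  obtain a b where l: "l = (a, b)" by (cases l)
  from Cons obtain w' where w': "w' \<in> words S" "(w' @ w, []) \<in> pres_cong S R" by auto
  from Cons l have a: "a \<in> S" and w: "w \<in> words S" by auto
  have "([(a, \<not> b), (a, b)], []) \<in> pres_cong S R"
    using pres_cong.cancel[OF a, of "\<not> b"] by simp
  from pres_cong.append[OF this pres_cong.refl[OF w]]
  have "([(a, \<not> b), (a, b)] @ w, w) \<in> pres_cong S R" by simp
  from pres_cong.append[OF pres_cong.refl[OF w'(1)] this]
  have "((w' @ [(a, \<not> b)]) @ l # w, w' @ w) \<in> pres_cong S R" by (simp add: l)
  then have "((w' @ [(a, \<not> b)]) @ l # w, []) \<in> pres_cong S R"
    using w'(2) by (rule pres_cong.trans)
  moreover have "w' @ [(a, \<not> b)] \<in> words S" using w' a by auto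
  ultimately show ?case by blast
qed

lemma presented_group_group: "group (presented_group S R)"
proof (rule groupI)
  show "\<one>\<^bsub>presented_group S R\<^esub> \<in> carrier (presented_group S R)"
    by (simp add: presented_group_one presented_group_class_closed)
next
  fix x assume "x \<in> carrier (presented_group S R)"
  then obtain u where u: "u \<in> words S" "x = pres_cong S R `` {u}"
    by (rule presented_group_carrierE)
  then show "\<one>\<^bsub>presented_group S R\<^esub> \<otimes>\<^bsub>presented_group S R\<^esub> x = x"
    by (simp add: presented_group_one presented_group_mult_class)
  from word_inverse[OF u(1)] obtain w
    where w: "w \<in> words S" "(w @ u, []) \<in> pres_cong S R" by blast
  have "(pres_cong S R `` {w}) \<otimes>\<^bsub>presented_group S R\<^esub> x = \<one>\<^bsub>presented_group S R\<^esub>"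
    using w u equiv_class_eq[OF equiv_pres_cong w(2)]
    by (simp add: presented_group_one presented_group_mult_class)
  then show "\<exists>y\<in>carrier (presented_group S R).
      y \<otimes>\<^bsub>presented_group S R\<^esub> x = \<one>\<^bsub>presented_group S R\<^esub>"
    using presented_group_class_closed[OF w(1)] by blast
next
  fix x y assume "x \<in> carrier (presented_group S R)" "y \<in> carrier (presented_group S R)"
  then obtain u v where uv: "u \<in> words S" "x = pres_cong S R `` {u}" "v \<in> words S" "y = pres_cong S R `` {v}"
    by (metis presented_group_carrierE)
  then have "u @ v \<in> words S" by simp
  with uv show "x \<otimes>\<^bsub>presented_group S R\<^esub> y \<in> carrier (presented_group S R)"
    by (simp only: presented_group_mult_class presented_group_class_closed)
  fix z assume "z \<in> carrier (presented_group S R)"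
  then obtain w where w: "w \<in> words S" "z = pres_cong S R `` {w}"
    by (rule presented_group_carrierE)
  then have "v @ w \<in> words S" using uv by simp
  with uv w \<open>u @ v \<in> words S\<close> show "x \<otimes>\<^bsub>presented_group S R\<^esub> y \<otimes>\<^bsub>presented_group S R\<^esub> z
      = x \<otimes>\<^bsub>presented_group S R\<^esub> (y \<otimes>\<^bsub>presented_group S R\<^esub> z)"
    by (simp only: presented_group_mult_class append_assoc)
qed

context
  fixes G :: "('g, 'b) monoid_scheme" (structure) and S :: "'a set"
    and R :: "('a word \<times> 'a word) set" and f :: "'a \<Rightarrow> 'g"
  assumes G: "group G" and f: "\<And>a. a \<in> S \<Longrightarrow> f a \<in> carrier G"
begin

interpretation group G by (fact G)

lemma word_eval_closed: "w \<in> words S \<Longrightarrow> word_eval G f w \<in> carrier G"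
  by (induction w) (auto simp: word_eval_def f)

lemma word_eval_append:
  "u \<in> words S \<Longrightarrow> v \<in> words S \<Longrightarrow> word_eval G f (u @ v) = word_eval G f u \<otimes> word_eval G f v"
proof (induction u)
  case Nil
  then show ?case using word_eval_closed[of v] by (simp add: word_eval_def)
next
  case (Cons l u)
  obtain a b where l: "l = (a, b)" by (cases l)
  have "letter_eval G f l \<in> carrier G" using Cons.prems l by (auto simp: f)
  then show ?case
    using Cons word_eval_closed[of u] word_eval_closed[of v]
    by (simp add: word_eval_def m_assoc)
qed

context
  assumes R: "\<And>u v. (u, v) \<in> R \<Longrightarrow> u \<in> words S \<Longrightarrow> v \<in> words S \<Longrightarrow> word_eval G f u = word_eval G f v"
begin

lemma word_eval_pres_cong: "(u, v) \<in> pres_cong S R \<Longrightarrow> word_eval G f u = word_eval G f v"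
proof (induction rule: pres_cong.induct)
  case (append u v u' v')
  then show ?case
    using pres_cong_words[of u v] pres_cong_words[of u' v'] by (simp add: word_eval_append)
next
  case (cancel a b)
  then show ?case by (auto simp: word_eval_def f)
next
  case (rel u v)
  then show ?case by (rule R)
qed auto

lemma pres_hom_class:
  assumes "w \<in> words S"
  shows "pres_hom G f (pres_cong S R `` {w}) = word_eval G f w"
proof -
  have "word_eval G f ` (pres_cong S R `` {w}) = {word_eval G f w}"
    using word_eval_pres_cong pres_cong.refl[OF assms] by (auto simp: image_iff) 
  then show ?thesis by (simp add: pres_hom_def)
qed

lemma pres_hom_hom: "pres_hom G f \<in> hom (presented_group S R) G"
proof (rule homI)
  fix x assume "x \<in> carrier (presented_group S R)"
  then show "pres_hom G f x \<in> carrier G"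
    by (elim presented_group_carrierE) (simp only: pres_hom_class word_eval_closed)
next
  fix x y assume "x \<in> carrier (presented_group S R)" "y \<in> carrier (presented_group S R)"
  then obtain u v where uv: "u \<in> words S" "x = pres_cong S R `` {u}" "v \<in> words S" "y = pres_cong S R `` {v}"
    by (metis presented_group_carrierE)
  then have "u @ v \<in> words S" by simp
  then show "pres_hom G f (x \<otimes>\<^bsub>presented_group S R\<^esub> y) = pres_hom G f x \<otimes> pres_hom G f y"
    unfolding uv(2,4) presented_group_mult_class[OF uv(1,3)]
    by (simp only: pres_hom_class uv(1,3) word_eval_append)
qed

lemma pres_hom_generator: "a \<in> S \<Longrightarrow> pres_hom G f (pres_cong S R `` {[(a, True)]}) = f a"
  by (subst pres_hom_class) (auto simp: word_eval_def f)

end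

end


section \<open>Twin groups and pure twin groups\<close>

definition twin_relations :: "nat \<Rightarrow> (nat word \<times> nat word) set" where
  "twin_relations n =
     {([(k, True), (k, True)], []) | k. k \<in> {1..n-1}} \<union>
     {([(i, True), (j, True)], [(j, True), (i, True)]) | i j.
        i \<in> {1..n-1} \<and> j \<in> {1..n-1} \<and> \<bar>int i - int j\<bar> \<ge> 2}"

definition twin_group :: "nat \<Rightarrow> nat word set monoid" where
  "twin_group n = presented_group {1..n-1} (twin_relations n)"

definition twin_perm :: "nat \<Rightarrow> nat word set \<Rightarrow> (nat \<Rightarrow> nat)" where
  "twin_perm n = pres_hom (sym_group n) (\<lambda>i. transpose i (i + 1))"

lemma twin_perm_respects:
  assumes "(u, v) \<in> twin_relations n"
  shows "word_eval (sym_group n) (\<lambda>i. transpose i (i + 1)) u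
       = word_eval (sym_group n) (\<lambda>i. transpose i (i + 1)) v"
proof -
  have "transpose i (i + 1) \<circ> transpose j (j + 1) = transpose j (j + 1) \<circ> transpose i (i + 1)"
    if "\<bar>int i - int j\<bar> \<ge> 2" for i j
  proof
    fix x
    have "i \<noteq> j" "i + 1 \<noteq> j" "i \<noteq> j + 1" using that by auto
    then show "(transpose i (i + 1) \<circ> transpose j (j + 1)) x
             = (transpose j (j + 1) \<circ> transpose i (i + 1)) x"
      unfolding transpose_def by simp
  qed
  then show ?thesis
    using assms by (auto simp: twin_relations_def word_eval_def sym_group_def)
qed

lemma twin_perm_closed: "i \<in> {1..n-1} \<Longrightarrow> transpose i (i + 1) \<in> carrier (sym_group n)"
  by (auto simp: sym_group_carrier intro!: permutes_swap_id)

lemma twin_perm_hom: "twin_perm n \<in> hom (twin_group n) (sym_group n)"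
  unfolding twin_perm_def twin_group_def
  by (rule pres_hom_hom[OF sym_group_is_group twin_perm_closed twin_perm_respects])

lemma twin_perm_generator:
  "i \<in> {1..n-1} \<Longrightarrow>
   twin_perm n (pres_cong {1..n-1} (twin_relations n) `` {[(i, True)]}) = transpose i (i + 1)"
  unfolding twin_perm_def
  by (rule pres_hom_generator[OF sym_group_is_group twin_perm_closed twin_perm_respects])

definition pure_twin_group :: "nat \<Rightarrow> nat word set set" where
  "pure_twin_group n = kernel (twin_group n) (sym_group n) (twin_perm n)"


section \<open>The Tits representation and its congruence subgroups\<close>

definition GL_int :: "nat \<Rightarrow> int mat monoid" where
  "GL_int d = units_of (ring_mat TYPE(int) d ())"

definition reduce_mat :: "int \<Rightarrow> int mat \<Rightarrow> int mat" where
  "reduce_mat m = map_mat (\<lambda>x. x mod m)"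

text \<open>Residues modulo \<open>m\<close> are represented by \<open>0, \<dots>, m - 1\<close>.\<close>

definition mod_mat_monoid :: "nat \<Rightarrow> int \<Rightarrow> int mat monoid" where
  "mod_mat_monoid d m =
     \<lparr> carrier = {A \<in> carrier_mat d d. elements_mat A \<subseteq> {0..<m}},
       mult = (\<lambda>A B. reduce_mat m (A * B)),
       one = 1\<^sub>m d \<rparr>"

definition GL_mod :: "nat \<Rightarrow> int \<Rightarrow> int mat monoid" where
  "GL_mod d m = units_of (mod_mat_monoid d m)"

text \<open>Rows and columns of \<open>mat\<close> are numbered from \<open>0\<close>, hence the shift by one.\<close>

definition tits_mat :: "nat \<Rightarrow> nat \<Rightarrow> int mat" where
  "tits_mat d i = mat d d (\<lambda>(r, c).
     if r + 1 = i then
       (if c + 1 = i then -1 else if c + 1 = i + 1 \<or> c + 1 = i - 1 then 2 else 0)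
     else (if r = c then 1 else 0))"

lemma tits_mat_carrier [simp]: "tits_mat d i \<in> carrier_mat d d"
  by (simp add: tits_mat_def)

lemma tits_mat_mult_entry:
  assumes r: "r < d" and c: "c < d" and i: "i \<in> {1..d}" and A: "A \<in> carrier_mat d d"
  shows "(tits_mat d i * A) $$ (r, c) =
    (if r + 1 = i then - (A $$ (r, c)) + (if r + 1 < d then 2 * A $$ (r + 1, c) else 0)
                       + (if 0 < r then 2 * A $$ (r - 1, c) else 0)
     else A $$ (r, c))"
proof -
  have "(tits_mat d i * A) $$ (r, c) = (\<Sum>l<d. tits_mat d i $$ (r, l) * A $$ (l, c))"
    using r c A by (auto simp: scalar_prod_def lessThan_atLeast0 tits_mat_def intro!: sum.cong)
  also have "\<dots> = (\<Sum>l<d. if r + 1 = i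
      then (if l = r then - (A $$ (r, c)) else 0)
         + (if l = r + 1 then 2 * A $$ (r + 1, c) else 0)
         + (if 0 < r \<and> l = r - 1 then 2 * A $$ (r - 1, c) else 0)
      else (if l = r then A $$ (r, c) else 0))"
    using r by (intro sum.cong) (auto simp: tits_mat_def)
  also have "\<dots> = (if r + 1 = i then - (A $$ (r, c)) + (if r + 1 < d then 2 * A $$ (r + 1, c) else 0)
                       + (if 0 < r then 2 * A $$ (r - 1, c) else 0)
     else A $$ (r, c))"
    using r by (cases "r + 1 = i"; cases "0 < r") (simp_all add: sum.distrib)
  finally show ?thesis .
qed

lemma tits_mat_entry:
  "r < d \<Longrightarrow> c < d \<Longrightarrow> tits_mat d i $$ (r, c) =
     (if r + 1 = i then
       (if c + 1 = i then -1 else if c + 1 = i + 1 \<or> c + 1 = i - 1 then 2 else 0)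
     else (if r = c then 1 else 0))"
  by (simp add: tits_mat_def)

lemma tits_mat_square:
  assumes i: "i \<in> {1..d}"
  shows "tits_mat d i * tits_mat d i = 1\<^sub>m d"
proof (rule eq_matI)
  fix r c assume "r < dim_row (1\<^sub>m d :: int mat)" "c < dim_col (1\<^sub>m d :: int mat)"
  then have rc: "r < d" "c < d" by auto
  show "(tits_mat d i * tits_mat d i) $$ (r, c) = 1\<^sub>m d $$ (r, c)"
  proof (cases "r + 1 = i")
    case True
    then show ?thesis
      unfolding tits_mat_mult_entry[OF rc i tits_mat_carrier]
      using rc by (auto simp: tits_mat_entry)
  next
    case False
    then show ?thesis
      unfolding tits_mat_mult_entry[OF rc i tits_mat_carrier]
      using rc by (simp add: tits_mat_entry)
  qed
qed (auto simp: tits_mat_def)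

lemma tits_mat_commute:
  assumes i: "i \<in> {1..d}" and j: "j \<in> {1..d}" and ij: "\<bar>int i - int j\<bar> \<ge> 2"
  shows "tits_mat d i * tits_mat d j = tits_mat d j * tits_mat d i"
proof (rule eq_matI)
  fix r c assume "r < dim_row (tits_mat d j * tits_mat d i)" "c < dim_col (tits_mat d j * tits_mat d i)"
  then have rc: "r < d" "c < d" by (auto simp: tits_mat_def)
  have *: "r + 1 \<noteq> j \<and> r + 2 \<noteq> j \<and> r \<noteq> j" if "r + 1 = i" using ij that by auto
  have **: "r + 1 \<noteq> i \<and> r + 2 \<noteq> i \<and> r \<noteq> i" if "r + 1 = j" using ij that by auto
  consider "r + 1 = i" | "r + 1 = j" | "r + 1 \<noteq> i" "r + 1 \<noteq> j" by blast
  then show "(tits_mat d i * tits_mat d j) $$ (r, c) = (tits_mat d j * tits_mat d i) $$ (r, c)"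
  proof cases
    case 1
    then show ?thesis
      unfolding tits_mat_mult_entry[OF rc i tits_mat_carrier] tits_mat_mult_entry[OF rc j tits_mat_carrier]
      using rc * by (auto simp: tits_mat_entry)
  next
    case 2
    then show ?thesis
      unfolding tits_mat_mult_entry[OF rc i tits_mat_carrier] tits_mat_mult_entry[OF rc j tits_mat_carrier]
      using rc ** by (auto simp: tits_mat_entry)
  next
    case 3
    then show ?thesis
      unfolding tits_mat_mult_entry[OF rc i tits_mat_carrier] tits_mat_mult_entry[OF rc j tits_mat_carrier]
      using rc by (simp add: tits_mat_entry)
  qed
qed (auto simp: tits_mat_def)

lemma GL_int_group: "group (GL_int d)"
  unfolding GL_int_def
  by (rule monoid.units_group) (rule semiring.axioms(2)[OF semiring_mat])

lemma tits_mat_closed: "i \<in> {1..d} \<Longrightarrow> tits_mat d i \<in> carrier (GL_int d)"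
  using tits_mat_square[of i d]
  by (auto simp: GL_int_def units_of_carrier Units_def ring_mat_simps intro!: bexI[of _ "tits_mat d i"])

lemma tits_respects:
  assumes "(u, v) \<in> twin_relations n"
  shows "word_eval (GL_int (n - 1)) (tits_mat (n - 1)) u = word_eval (GL_int (n - 1)) (tits_mat (n - 1)) v"
  using assms
  by (auto simp: twin_relations_def word_eval_def GL_int_def units_of_mult units_of_one
      ring_mat_simps tits_mat_square tits_mat_commute right_mult_one_mat[OF tits_mat_carrier])

definition tits_rep :: "nat \<Rightarrow> nat word set \<Rightarrow> int mat" where
  "tits_rep n = pres_hom (GL_int (n - 1)) (tits_mat (n - 1))"

lemma tits_rep_hom: "tits_rep n \<in> hom (twin_group n) (GL_int (n - 1))"
  unfolding tits_rep_def twin_group_def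
  by (rule pres_hom_hom[OF GL_int_group tits_mat_closed tits_respects])

lemma tits_rep_generator:
  "i \<in> {1..n-1} \<Longrightarrow>
   tits_rep n (pres_cong {1..n-1} (twin_relations n) `` {[(i, True)]}) = tits_mat (n - 1) i"
  unfolding tits_rep_def
  by (rule pres_hom_generator[OF GL_int_group tits_mat_closed tits_respects])

lemma reduce_mat_mult_reduce:
  assumes "A \<in> carrier_mat d d" "B \<in> carrier_mat d d"
  shows "reduce_mat m (reduce_mat m A * B) = reduce_mat m (A * B)"
    and "reduce_mat m (A * reduce_mat m B) = reduce_mat m (A * B)"
proof -
  have 1: "(\<Sum>l=0..<d. (f l mod m) * g l) mod m = (\<Sum>l=0..<d. f l * g l) mod m"
    and 2: "(\<Sum>l=0..<d. f l * (g l mod m)) mod m = (\<Sum>l=0..<d. f l * g l) mod m"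
    for f g :: "nat \<Rightarrow> int"
    by (subst (1 2) mod_sum_eq[symmetric], simp add: mod_mult_left_eq mod_mult_right_eq)+
  show "reduce_mat m (reduce_mat m A * B) = reduce_mat m (A * B)"
    using assms 1[of "\<lambda>l. A $$ (i, l)" "\<lambda>l. B $$ (l, j)" for i j]
    by (auto simp: reduce_mat_def scalar_prod_def intro!: eq_matI)
  show "reduce_mat m (A * reduce_mat m B) = reduce_mat m (A * B)"
    using assms 2[of "\<lambda>l. A $$ (i, l)" "\<lambda>l. B $$ (l, j)" for i j]
    by (auto simp: reduce_mat_def scalar_prod_def intro!: eq_matI)
qed

lemma reduce_mat_carrier [simp]: "reduce_mat m A \<in> carrier_mat d d \<longleftrightarrow> A \<in> carrier_mat d d"
  by (auto simp: reduce_mat_def)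

lemma reduce_mat_closed:
  "m > 0 \<Longrightarrow> A \<in> carrier_mat d d \<Longrightarrow> reduce_mat m A \<in> carrier (mod_mat_monoid d m)"
  by (auto simp: mod_mat_monoid_def reduce_mat_def dest!: elements_matD)

lemma reduce_mat_id:
  assumes "A \<in> carrier (mod_mat_monoid d m)"
  shows "reduce_mat m A = A"
proof (rule eq_matI)
  fix i j assume "i < dim_row A" "j < dim_col A"
  moreover from this have "A $$ (i, j) \<in> elements_mat A" by (intro elements_matI) auto
  ultimately show "reduce_mat m A $$ (i, j) = A $$ (i, j)"
    using assms by (auto simp: mod_mat_monoid_def reduce_mat_def)
qed (auto simp: reduce_mat_def)

lemma reduce_mat_one: "m \<ge> 2 \<Longrightarrow> reduce_mat m (1\<^sub>m d) = 1\<^sub>m d"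
  by (auto simp: reduce_mat_def intro!: eq_matI)

lemma mod_mat_monoid_monoid:
  assumes m: "m \<ge> 2"
  shows "monoid (mod_mat_monoid d m)"
proof (rule monoidI)
  fix A B assume AB: "A \<in> carrier (mod_mat_monoid d m)" "B \<in> carrier (mod_mat_monoid d m)"
  then have c: "A \<in> carrier_mat d d" "B \<in> carrier_mat d d" by (auto simp: mod_mat_monoid_def)
  then show "A \<otimes>\<^bsub>mod_mat_monoid d m\<^esub> B \<in> carrier (mod_mat_monoid d m)"
    using m reduce_mat_closed[of m "A * B" d] by (simp add: mod_mat_monoid_def)
  fix C assume "C \<in> carrier (mod_mat_monoid d m)"
  then have "C \<in> carrier_mat d d" by (auto simp: mod_mat_monoid_def)
  with c show "A \<otimes>\<^bsub>mod_mat_monoid d m\<^esub> B \<otimes>\<^bsub>mod_mat_monoid d m\<^esub> C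
      = A \<otimes>\<^bsub>mod_mat_monoid d m\<^esub> (B \<otimes>\<^bsub>mod_mat_monoid d m\<^esub> C)"
    by (simp add: mod_mat_monoid_def reduce_mat_mult_reduce[of _ d] assoc_mult_mat[of A d d B d C d])
next
  show "\<one>\<^bsub>mod_mat_monoid d m\<^esub> \<in> carrier (mod_mat_monoid d m)"
    using reduce_mat_closed[of m "1\<^sub>m d" d] reduce_mat_one[OF m] m by (simp add: mod_mat_monoid_def)
next
  fix A assume A: "A \<in> carrier (mod_mat_monoid d m)"
  then have c: "A \<in> carrier_mat d d" by (auto simp: mod_mat_monoid_def)
  show "\<one>\<^bsub>mod_mat_monoid d m\<^esub> \<otimes>\<^bsub>mod_mat_monoid d m\<^esub> A = A"
    and "A \<otimes>\<^bsub>mod_mat_monoid d m\<^esub> \<one>\<^bsub>mod_mat_monoid d m\<^esub> = A"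
    using c reduce_mat_id[OF A] by (simp_all add: mod_mat_monoid_def)
qed

lemma GL_mod_group: "m \<ge> 2 \<Longrightarrow> group (GL_mod d m)"
  unfolding GL_mod_def by (rule monoid.units_group) (rule mod_mat_monoid_monoid)

lemma reduce_mat_hom:
  assumes m: "m \<ge> 2"
  shows "reduce_mat m \<in> hom (GL_int d) (GL_mod d m)"
proof (rule homI)
  fix A assume "A \<in> carrier (GL_int d)"
  then obtain B where AB: "A \<in> carrier_mat d d" "B \<in> carrier_mat d d" "A * B = 1\<^sub>m d" "B * A = 1\<^sub>m d"
    by (auto simp: GL_int_def units_of_carrier Units_def ring_mat_simps)
  have "reduce_mat m (reduce_mat m A * reduce_mat m B) = 1\<^sub>m d"
    "reduce_mat m (reduce_mat m B * reduce_mat m A) = 1\<^sub>m d"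
    using AB by (simp_all add: reduce_mat_mult_reduce[of _ d] reduce_mat_one[OF m])
  moreover have "reduce_mat m A \<in> carrier (mod_mat_monoid d m)"
    "reduce_mat m B \<in> carrier (mod_mat_monoid d m)"
    using AB m by (auto intro: reduce_mat_closed)
  moreover have "A \<otimes>\<^bsub>mod_mat_monoid d m\<^esub> B = reduce_mat m (A * B)"
    "\<one>\<^bsub>mod_mat_monoid d m\<^esub> = 1\<^sub>m d" for A B
    by (simp_all add: mod_mat_monoid_def)
  ultimately show "reduce_mat m A \<in> carrier (GL_mod d m)"
    unfolding GL_mod_def units_of_carrier Units_def by auto
next
  fix A B assume "A \<in> carrier (GL_int d)" "B \<in> carrier (GL_int d)"
  then have "A \<in> carrier_mat d d" "B \<in> carrier_mat d d"
    by (auto simp: GL_int_def units_of_carrier Units_def ring_mat_simps)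
  then show "reduce_mat m (A \<otimes>\<^bsub>GL_int d\<^esub> B) = reduce_mat m A \<otimes>\<^bsub>GL_mod d m\<^esub> reduce_mat m B"
    by (simp add: GL_int_def GL_mod_def units_of_mult ring_mat_simps mod_mat_monoid_def
        reduce_mat_mult_reduce[of _ d])
qed

definition twin_congruence_subgroup :: "nat \<Rightarrow> int \<Rightarrow> nat word set set" where
  "twin_congruence_subgroup n m =
     kernel (twin_group n) (GL_mod (n - 1) m) (reduce_mat m \<circ> tits_rep n)"

end

theory Submission
  imports Defs
begin

text \<open>Modulo 2 every matrix \<open>X\<^sub>i\<close> is the identity, so the image of the whole twin group is trivial
  modulo 2, and being trivial modulo 6 amounts to being trivial modulo 3.

  Modulo 3 the off-diagonal entries \<open>2\<close> of \<open>X\<^sub>i\<close> become \<open>-1\<close>. Conjugating by the diagonal matrix with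
  entries \<open>(-1)\<^sup>k\<close> turns them into \<open>1\<close>, which gives the matrix of the transposition \<open>(i, i + 1)\<close>
  acting on the root lattice of type \<open>A\<close> in the basis of simple roots
  \<open>\<alpha>\<^sub>j = e\<^sub>j - e\<^bsub>j+1\<^esub>\<close>. Hence the Tits representation modulo 3 factors through the symmetric
  group. A permutation \<open>p\<close> maps \<open>\<alpha>\<^sub>j\<close> to \<open>e\<^bsub>p j\<^esub> - e\<^bsub>p (j+1)\<^esub>\<close>, and the coefficient of
  \<open>\<alpha>\<^sub>k\<close> in a vector of coordinate sum zero is the sum of its first \<open>k\<close> coordinates. So the entry in
  row \<open>k\<close> and column \<open>j\<close> is explicit, namely
  \<open>[p j \<le> k] - [p (j + 1) \<le> k]\<close> (\<open>root_coeff\<close>); lemma \<open>tits_word_mod_3\<close> confirms the resulting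
  formula by induction on words. These coefficients lie in \<open>{-1, 0, 1}\<close>, whose elements are
  distinct modulo 3, so the action of \<open>S\<^sub>n\<close> on the root lattice remains faithful modulo 3
  (\<open>root_coeff_faithful\<close>) and the kernel modulo 3 is exactly the pure twin group.\<close>

section \<open>Evaluating words in matrices and in permutations\<close>

text \<open>The two evaluations of a word that are compared below. The generators are involutions on both
  sides, so a letter and its formal inverse evaluate to the same element.\<close>

definition tits_word :: "nat \<Rightarrow> nat word \<Rightarrow> int mat" where
  "tits_word d = word_eval (GL_int d) (tits_mat d)"

definition perm_word :: "nat \<Rightarrow> nat word \<Rightarrow> nat \<Rightarrow> nat" where
  "perm_word n = word_eval (sym_group n) (\<lambda>i. transpose i (i + 1))"

lemma tits_word_Nil: "tits_word d [] = 1\<^sub>m d"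
  by (simp add: tits_word_def word_eval_def GL_int_def units_of_one ring_mat_simps)

lemma tits_word_Cons:
  assumes "a \<in> {1..d}"
  shows "tits_word d ((a, b) # w) = tits_mat d a * tits_word d w"
proof -
  interpret group "GL_int d" by (rule GL_int_group)
  have "inv\<^bsub>GL_int d\<^esub> tits_mat d a = tits_mat d a"
    using tits_mat_square[OF assms] tits_mat_closed[OF assms]
    by (intro inv_equality) (auto simp: GL_int_def units_of_mult units_of_one ring_mat_simps)
  then show ?thesis
    by (simp add: tits_word_def word_eval_def GL_int_def units_of_mult ring_mat_simps)
qed

lemma tits_word_carrier:
  assumes "w \<in> words {1..d}"
  shows "tits_word d w \<in> carrier_mat d d"
proof -
  have "tits_word d w \<in> carrier (GL_int d)"
    unfolding tits_word_def by (rule word_eval_closed[OF GL_int_group tits_mat_closed assms])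
  then show ?thesis
    by (auto simp: GL_int_def units_of_carrier Units_def ring_mat_simps)
qed

lemma perm_word_Nil: "perm_word n [] = id"
  by (simp add: perm_word_def word_eval_def sym_group_def)

lemma perm_word_Cons:
  assumes "a \<in> {1..n-1}"
  shows "perm_word n ((a, b) # w) = transpose a (a + 1) \<circ> perm_word n w"
proof -
  interpret group "sym_group n" by (rule sym_group_is_group)
  have "inv\<^bsub>sym_group n\<^esub> transpose a (a + 1) = transpose a (a + 1)"
    using twin_perm_closed[OF assms]
    by (intro inv_equality) (auto simp: sym_group_def)
  then show ?thesis
    by (simp add: perm_word_def word_eval_def sym_group_def)
qed

lemma perm_word_permutes:
  assumes "w \<in> words {1..n-1}"
  shows "perm_word n w permutes {1..n}"
  using word_eval_closed[OF sym_group_is_group twin_perm_closed assms]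
  by (simp add: perm_word_def sym_group_carrier)

section \<open>The Tits representation modulo 2\<close>

text \<open>All off-diagonal entries of \<open>X\<^sub>i\<close> are even, and its diagonal entries are odd.\<close>

lemma tits_word_mod_2:
  assumes "w \<in> words {1..d}" "r < d" "c < d"
  shows "even (tits_word d w $$ (r, c) - 1\<^sub>m d $$ (r, c))"
  using assms(1)
proof (induction w rule: list.induct)
  case Nil
  then show ?case by (simp add: tits_word_Nil)
next
  case (Cons l w)
  obtain a b where l: "l = (a, b)" by (cases l)
  have a: "a \<in> {1..d}" and w: "w \<in> words {1..d}" using Cons.prems l by auto
  show ?case
    unfolding l tits_word_Cons[OF a] tits_mat_mult_entry[OF assms(2,3) a tits_word_carrier[OF w]]
    using Cons.IH[OF w] by auto
qed

section \<open>The action of permutations on the root lattice\<close>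

text \<open>The coefficient of \<open>\<alpha>\<^sub>k\<close> in the image \<open>e\<^bsub>p j\<^esub> - e\<^bsub>p (j+1)\<^esub>\<close> of \<open>\<alpha>\<^sub>j\<close> under \<open>p\<close>.\<close>

definition root_coeff :: "(nat \<Rightarrow> nat) \<Rightarrow> nat \<Rightarrow> nat \<Rightarrow> int" where
  "root_coeff p k j = of_bool (p j \<le> k) - of_bool (p (j + 1) \<le> k)"

text \<open>The transposition \<open>(i, i + 1)\<close> exchanges the coordinates \<open>i\<close> and \<open>i + 1\<close>, which affects only
  the \<open>i\<close>-th of the partial sums of coordinates, replacing \<open>S\<^sub>i\<close> by
  \<open>S\<^bsub>i-1\<^esub> + S\<^bsub>i+1\<^esub> - S\<^sub>i\<close>.\<close>

lemma root_coeff_transpose_comp: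
  assumes "i \<ge> 1"
  shows "root_coeff (transpose i (i + 1) \<circ> p) k j =
    (if k = i then root_coeff p (i - 1) j + root_coeff p (i + 1) j - root_coeff p i j
     else root_coeff p k j)"
proof -
  have "of_bool (transpose i (i + 1) x \<le> k) =
      (if k = i then of_bool (x \<le> i - 1) + of_bool (x \<le> i + 1) - of_bool (x \<le> i)
       else of_bool (x \<le> k) :: int)" for x
    using assms by (auto simp: transpose_def)
  then show ?thesis by (simp add: root_coeff_def)
qed

text \<open>The partial sums of no coordinates and of all coordinates vanish. This makes the rule for
  \<open>X\<^sub>i\<close> uniform at the two ends, where one of the neighbouring rows is absent.\<close>

lemma root_coeff_boundary:
  assumes "p permutes {1..n}" "j \<in> {1..n-1}"
  shows "root_coeff p 0 j = 0" "root_coeff p n j = 0"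
proof -
  have "j \<in> {1..n}" "j + 1 \<in> {1..n}"
    using assms(2) by auto
  then have "p j \<in> {1..n}" "p (j + 1) \<in> {1..n}"
    by (simp_all only: permutes_in_image[OF assms(1)])
  then show "root_coeff p 0 j = 0" "root_coeff p n j = 0"
    by (auto simp: root_coeff_def)
qed

text \<open>The action is already determined to be trivial by its diagonal coefficients: a difference of two truth values that is \<open>1\<close> modulo 3 equals
  \<open>1\<close>, so \<open>p j \<le> j < p (j + 1)\<close> for all \<open>j < n\<close>. The second half for \<open>j - 1\<close> gives \<open>j \<le> p j\<close>.
  At the ends \<open>j = 1\<close> and \<open>j = n\<close> the missing inequality holds because \<open>p j\<close> lies in
  \<open>{1..n}\<close>.\<close>

lemma root_coeff_faithful:
  assumes p: "p permutes {1..n}"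
    and diagonal: "\<And>j. j \<in> {1..n-1} \<Longrightarrow> 3 dvd root_coeff p j j - 1"
  shows "p = id"
proof
  fix j
  have step: "p j \<le> j \<and> j < p (j + 1)" if "j \<in> {1..n-1}" for j
    using diagonal[OF that] by (auto simp: root_coeff_def of_bool_def split: if_splits)
  have range: "p j \<in> {1..n}" if "j \<in> {1..n}" for j
    using that permutes_in_image[OF p] by blast
  have "p j \<le> j \<and> j \<le> p j" if j: "j \<in> {1..n}"
  proof
    show "p j \<le> j"
      using j step[of j] range[OF j] by (cases "j = n") auto
    show "j \<le> p j"
    proof (cases "j = 1")
      case False
      then have "j - 1 \<in> {1..n-1}" "j - 1 + 1 = j" using j by auto
      then show ?thesis using step[of "j - 1"] by simp
    qed (use range[OF j] in auto)
  qed
  then show "p j = id j"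
    using permutes_not_in[OF p] by (cases "j \<in> {1..n}") auto
qed

section \<open>The Tits representation modulo 3\<close>

text \<open>The Tits representation modulo 3 is the action on the root lattice, conjugated by alternating
  signs. Rows and columns are counted from \<open>0\<close>, simple roots from \<open>1\<close>.\<close>

lemma tits_word_mod_3:
  assumes "w \<in> words {1..d}" "r < d" "c < d"
  shows "3 dvd tits_word d w $$ (r, c) - (-1) ^ (r + c) * root_coeff (perm_word (d + 1) w) (r + 1) (c + 1)"
  using assms(1,2)
proof (induction w arbitrary: r rule: list.induct)
  case Nil
  then show ?case
    using assms(3) by (auto simp: tits_word_Nil perm_word_Nil root_coeff_def)
next
  case (Cons l w)
  obtain a b where l: "l = (a, b)" by (cases l)
  have a: "a \<in> {1..d}" and w: "w \<in> words {1..d}" using Cons.prems l by auto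
  define A where "A = tits_word d w"
  define B where "B k = root_coeff (perm_word (d + 1) w) k (c + 1)" for k
  have IH: "3 dvd A $$ (s, c) - (-1) ^ (s + c) * B (s + 1)" if "s < d" for s
    using Cons.IH[OF w that] by (simp add: A_def B_def)
  have bd: "B 0 = 0" "B (d + 1) = 0"
    using root_coeff_boundary[OF perm_word_permutes, of w "d + 1" "c + 1"] w assms(3)
    by (simp_all add: B_def)
  have entry: "tits_word d (l # w) $$ (r, c) =
      (if r + 1 = a then - (A $$ (r, c)) + (if r + 1 < d then 2 * A $$ (r + 1, c) else 0)
                         + (if 0 < r then 2 * A $$ (r - 1, c) else 0)
       else A $$ (r, c))"
    unfolding l tits_word_Cons[OF a] A_def
    by (rule tits_mat_mult_entry[OF Cons.prems(2) assms(3) a tits_word_carrier[OF w]])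
  have coeff: "root_coeff (perm_word (d + 1) (l # w)) (r + 1) (c + 1) =
      (if r + 1 = a then B r + B (r + 2) - B (r + 1) else B (r + 1))"
    using a root_coeff_transpose_comp[of a "perm_word (d + 1) w" "r + 1" "c + 1"]
    by (auto simp: l perm_word_Cons B_def)
  show ?case
  proof (cases "r + 1 = a")
    case False
    then show ?thesis using entry coeff IH[OF Cons.prems(2)] by simp
  next
    case True
    define e :: int where "e = (-1) ^ (r + c)"
    have mid: "3 dvd A $$ (r, c) - e * B (r + 1)"
      using IH[OF Cons.prems(2)] by (simp add: e_def)
    \<comment> \<open>The neighbouring rows carry the opposite sign, and \<open>2\<close> is \<open>-1\<close> modulo 3.\<close>
    have next_row: "3 dvd (if r + 1 < d then 2 * A $$ (r + 1, c) else 0) - e * B (r + 2)"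
    proof (cases "r + 1 < d")
      case True
      have "3 dvd A $$ (r + 1, c) + e * B (r + 2)"
        using IH[OF True] by (simp add: e_def)
      then show ?thesis using True by simp presburger
    next
      case False
      then have "r + 2 = d + 1" using Cons.prems(2) by simp
      then show ?thesis using False bd(2) by simp
    qed
    have prev_row: "3 dvd (if 0 < r then 2 * A $$ (r - 1, c) else 0) - e * B r"
    proof (cases r)
      case 0
      then show ?thesis using bd(1) by simp
    next
      case (Suc s)
      have "3 dvd A $$ (s, c) + e * B r"
        using IH[of s] Cons.prems(2) Suc by (simp add: e_def)
      then show ?thesis using Suc by simp presburger
    qed
    have "3 dvd - (A $$ (r, c)) + x + y - e * (B r + B (r + 2) - B (r + 1))"
      if "3 dvd x - e * B (r + 2)" "3 dvd y - e * B r" for x y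
    proof -
      have "- (A $$ (r, c)) + x + y - e * (B r + B (r + 2) - B (r + 1)) =
          (x - e * B (r + 2)) + (y - e * B r) - (A $$ (r, c) - e * B (r + 1))"
        by (simp add: algebra_simps)
      then show ?thesis using that mid by (metis dvd_add dvd_diff)
    qed
    from this[OF next_row prev_row] show ?thesis
      using True entry coeff by (simp add: e_def)
  qed
qed

section \<open>Kernels\<close>

lemma reduce_mat_eq_one_iff:
  assumes "m \<ge> 2" "A \<in> carrier_mat d d"
  shows "reduce_mat m A = 1\<^sub>m d \<longleftrightarrow> (\<forall>r<d. \<forall>c<d. m dvd A $$ (r, c) - 1\<^sub>m d $$ (r, c))"
proof -
  have "reduce_mat m A = 1\<^sub>m d \<longleftrightarrow> reduce_mat m A = reduce_mat m (1\<^sub>m d)"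
    using assms(1) by (simp add: reduce_mat_one)
  also have "\<dots> \<longleftrightarrow> (\<forall>r<d. \<forall>c<d. A $$ (r, c) mod m = 1\<^sub>m d $$ (r, c) mod m)"
    using assms(2) by (auto simp: reduce_mat_def mat_eq_iff simp del: index_one_mat(1))
  finally show ?thesis by (simp only: mod_eq_dvd_iff)
qed

lemma tits_word_trivial_mod_6_iff:
  assumes "w \<in> words {1..d}"
  shows "reduce_mat 6 (tits_word d w) = 1\<^sub>m d \<longleftrightarrow> reduce_mat 3 (tits_word d w) = 1\<^sub>m d"
proof -
  have "6 dvd x \<longleftrightarrow> 3 dvd x" if "even x" for x :: int
    using that by presburger
  then show ?thesis
    using tits_word_mod_2[OF assms]
    by (simp add: reduce_mat_eq_one_iff[OF _ tits_word_carrier[OF assms]] del: index_one_mat(1))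
qed

lemma tits_word_trivial_mod_3_iff:
  assumes w: "w \<in> words {1..d}"
  shows "reduce_mat 3 (tits_word d w) = 1\<^sub>m d \<longleftrightarrow> perm_word (d + 1) w = id"
proof -
  let ?p = "perm_word (d + 1) w"
  \<comment> \<open>The alternating signs do not affect the condition: they are \<open>1\<close> on the diagonal, and off the
    diagonal the condition is divisibility.\<close>
  have entry: "3 dvd tits_word d w $$ (r, c) - 1\<^sub>m d $$ (r, c) \<longleftrightarrow>
      3 dvd root_coeff ?p (r + 1) (c + 1) - of_bool (r + 1 = c + 1)" if "r < d" "c < d" for r c
  proof -
    have "3 dvd x - of_bool (r = c) \<longleftrightarrow> 3 dvd y - of_bool (r = c)"
      if "3 dvd x - (-1) ^ (r + c) * y" for x y :: int
    proof (cases "r = c")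
      case True
      then have "3 dvd x - y" using that by simp
      then show ?thesis by presburger
    next
      case False
      have "3 dvd x \<longleftrightarrow> 3 dvd (-1) ^ (r + c) * y"
        using that by presburger
      also have "\<dots> \<longleftrightarrow> 3 dvd y"
        by (cases "even (r + c)") auto
      finally show ?thesis using False by simp
    qed
    from this[OF tits_word_mod_3[OF w that]] show ?thesis
      using that by (simp add: of_bool_def)
  qed
  have "reduce_mat 3 (tits_word d w) = 1\<^sub>m d \<longleftrightarrow>
      (\<forall>r<d. \<forall>c<d. 3 dvd root_coeff ?p (r + 1) (c + 1) - of_bool (r + 1 = c + 1))"
    using entry by (simp add: reduce_mat_eq_one_iff[OF _ tits_word_carrier[OF w]] del: index_one_mat(1))
  also have "\<dots> \<longleftrightarrow> ?p = id"
  proof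
    assume *: "\<forall>r<d. \<forall>c<d. 3 dvd root_coeff ?p (r + 1) (c + 1) - of_bool (r + 1 = c + 1)"
    show "?p = id"
    proof (rule root_coeff_faithful)
      show "?p permutes {1..d+1}"
        using w by (intro perm_word_permutes) simp
    next
      fix j assume "j \<in> {1..d+1-1}"
      then have "j - 1 < d" "j - 1 + 1 = j" by auto
      then show "3 dvd root_coeff ?p j j - 1"
        using *[rule_format, of "j - 1" "j - 1"] by simp
    qed
  next
    assume "?p = id"
    then show "\<forall>r<d. \<forall>c<d. 3 dvd root_coeff ?p (r + 1) (c + 1) - of_bool (r + 1 = c + 1)"
      by (auto simp: root_coeff_def)
  qed
  finally show ?thesis .
qed

lemma twin_groupE:
  assumes "x \<in> carrier (twin_group n)"
  obtains w where "w \<in> words {1..n-1}" "tits_rep n x = tits_word (n - 1) w"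
    "twin_perm n x = perm_word n w"
proof -
  from assms obtain w where w: "w \<in> words {1..n-1}"
    "x = pres_cong {1..n-1} (twin_relations n) `` {w}"
    unfolding twin_group_def by (rule presented_group_carrierE)
  show ?thesis
  proof (rule that[OF w(1)])
    show "tits_rep n x = tits_word (n - 1) w"
      unfolding tits_rep_def tits_word_def w(2)
      by (rule pres_hom_class[OF GL_int_group tits_mat_closed tits_respects w(1)])
    show "twin_perm n x = perm_word n w"
      unfolding twin_perm_def perm_word_def w(2)
      by (rule pres_hom_class[OF sym_group_is_group twin_perm_closed twin_perm_respects w(1)])
  qed
qed

lemma twin_congruence_subgroup_eq:
  "twin_congruence_subgroup n m =
     {x \<in> carrier (twin_group n). reduce_mat m (tits_rep n x) = 1\<^sub>m (n - 1)}"
  by (simp add: twin_congruence_subgroup_def kernel_def GL_mod_def units_of_one mod_mat_monoid_def)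

lemma pure_twin_group_eq:
  "pure_twin_group n = {x \<in> carrier (twin_group n). twin_perm n x = id}"
  by (simp add: pure_twin_group_def kernel_def sym_group_def)

theorem proposition3p17:
  fixes n :: nat
  assumes "n \<ge> 3"
  shows "twin_congruence_subgroup n 3 = twin_congruence_subgroup n 6
       \<and> twin_congruence_subgroup n 6 = pure_twin_group n"
proof -
  have "(reduce_mat 6 (tits_rep n x) = 1\<^sub>m (n - 1) \<longleftrightarrow> reduce_mat 3 (tits_rep n x) = 1\<^sub>m (n - 1)) \<and>
      (reduce_mat 3 (tits_rep n x) = 1\<^sub>m (n - 1) \<longleftrightarrow> twin_perm n x = id)"
    if "x \<in> carrier (twin_group n)" for x
    using that
  proof (rule twin_groupE)
    fix w assume w: "w \<in> words {1..n-1}" and eqs: "tits_rep n x = tits_word (n - 1) w"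
      "twin_perm n x = perm_word n w"
    have "n - 1 + 1 = n" using assms by simp
    then show ?thesis
      using tits_word_trivial_mod_6_iff[OF w] tits_word_trivial_mod_3_iff[OF w] eqs by simp
  qed
  then show ?thesis
    unfolding twin_congruence_subgroup_eq pure_twin_group_eq by blast
qed

end
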